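(* For any nominal transition system $\mathbf T$ with a distinguished action $\tau$ and states $P,Q$: if $P\stackrel{\cdot}{\approx}_{\mathbf T}Q$ then $P\stackrel{\cdot}{\approx}_{\mathcal S(\mathbf T)}Q$.
   Context: Nominal sets over a countably infinite (possibly sorted) set of names $\mathcal N$: permutations fix all but finitely many names; every element has finite support $\operatorname{supp}$; $a\# X$ means $a\notin\operatorname{supp}(X)$; $[\mathcal P_{\mathrm{fin}}(\mathcal N)]S$ is $\mathcal P_{\mathrm{fin}}(\mathcal N)\times S$ modulo $(N,X)=_\alpha(N',X')$ iff some $\pi$ with $\pi\cdot(N,X)=(N',X')$ fixes every name of $\operatorname{supp}(X)\setminus N$; classes $\langle N\rangle X$. A nominal transition system: nominal sets STATES, PRED, ACT; equivariant $\vdash\subseteq\mathrm{STATES}\times\mathrm{PRED}$; equivariant $\operatorname{bn}$, $\operatorname{bn}(\alpha)$ a finite subset of $\operatorname{supp}(\alpha)$; equivariant $\rightarrow\ \subseteq\mathrm{STATES}\times[\mathcal P_{\mathrm{fin}}(\mathcal N)](\mathrm{ACT}\times\mathrm{STATES})$ with $(P,\langle N\rangle(\alpha,Q))\in\rightarrow$ only if $N=\operatorname{bn}(\alpha)$; $P\xrightarrow{\alpha}P'$ means $(P,\langle\operatorname{bn}(\alpha)\rangle(\alpha,P'))\in\rightarrow$. $\tau\in\mathrm{ACT}$ is a special action with empty support. Weak transitions: $P\Rightarrow P'$ iff $P=P'$ or $P\xrightarrow{\tau}P''\Rightarrow P'$; $P\stackrel{\alpha}{\Rightarrow}P'$ iff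 $P\Rightarrow\circ\xrightarrow{\alpha}\circ\Rightarrow P'$; $P\stackrel{\hat\alpha}{\Rightarrow}P'$ is $P\Rightarrow P'$ if $\alpha=\tau$, else $P\stackrel{\alpha}{\Rightarrow}P'$. A weak bisimulation is a symmetric relation $R$ with: $R(P,Q)$ implies (weak simulation) whenever $\operatorname{bn}(\alpha)\# Q$ and $P\xrightarrow{\alpha}P'$, some $Q'$ has $Q\stackrel{\hat\alpha}{\Rightarrow}Q'$ and $R(P',Q')$; (weak static implication) whenever $P\vdash\varphi$, some $Q'$ has $Q\Rightarrow Q'$, $Q'\vdash\varphi$, $R(P,Q')$. $\stackrel{\cdot}{\approx}_{\mathbf T}$ is weak bisimilarity (union of weak bisimulations) in $\mathbf T$. $\mathcal S(\mathbf T)$ is the nominal transition system with: same states as $\mathbf T$; actions $\mathrm{ACT}_{\mathbf T}\uplus\mathrm{PRED}_{\mathbf T}$ (so $\tau$ is also its distinguished action); $\operatorname{bn}$ as in $\mathbf T$ on $\mathrm{ACT}_{\mathbf T}$ and $\operatorname{bn}(\varphi)=\emptyset$ for $\varphi\in\mathrm{PRED}_{\mathbf T}$; no state predicates hold; transitions $P\xrightarrow{\alpha}P'$ iff $P\xrightarrow{\alpha}P'$ in $\mathbf T$ (for $\alpha\in\mathrm{ACT}_{\mathbf T}$), and $P\xrightarrow{\varphi}P$ iff $P\vdash_{\mathbf T}\varphi$, with no other $\varphi$-transitions. *)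

theory Defs
  imports "HOL-Library.Countable_Set" "HOL-Combinatorics.Transposition"
begin

section \<open>Names and nominal sets\<close>

text \<open>The function \<open>srt\<close> assigns a sort to every name; the unsorted setting is the case
  of a constant function. Every sort that occurs is infinite, as is needed for finitely supported
  elements to have a least finite support.\<close>

definition sorted_names :: "('n \<Rightarrow> 'k) \<Rightarrow> bool" where
  "sorted_names srt \<longleftrightarrow>
     countable (UNIV :: 'n set) \<and> infinite (UNIV :: 'n set) \<and> (\<forall>a. infinite {b. srt b = srt a})"

definition perms :: "('n \<Rightarrow> 'k) \<Rightarrow> ('n \<Rightarrow> 'n) set" where
  "perms srt = {\<pi>. bij \<pi> \<and> finite {a. \<pi> a \<noteq> a} \<and> (\<forall>a. srt (\<pi> a) = srt a)}"

record ('n, 'x) nom =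
  elems :: "'x set"
  perm :: "('n \<Rightarrow> 'n) \<Rightarrow> 'x \<Rightarrow> 'x"

definition supports :: "('n \<Rightarrow> 'k) \<Rightarrow> ('n, 'x) nom \<Rightarrow> 'n set \<Rightarrow> 'x \<Rightarrow> bool" where
  "supports srt A N x \<longleftrightarrow>
     (\<forall>\<pi>\<in>perms srt. (\<forall>a\<in>N. \<pi> a = a) \<longrightarrow> perm A \<pi> x = x)"

definition nominal_set :: "('n \<Rightarrow> 'k) \<Rightarrow> ('n, 'x) nom \<Rightarrow> bool" where
  "nominal_set srt A \<longleftrightarrow>
     (\<forall>x\<in>elems A.
        perm A id x = x \<and>
        (\<forall>\<pi>\<in>perms srt. perm A \<pi> x \<in> elems A) \<and>
        (\<forall>\<pi>\<in>perms srt. \<forall>\<rho>\<in>perms srt. perm A (\<pi> \<circ> \<rho>) x = perm A \<pi> (perm A \<rho> x)) \<and>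
        (\<exists>N. finite N \<and> supports srt A N x))"

text \<open>The least finite supporting set, see lemma \<open>supp_least\<close> below.\<close>

definition supp :: "('n \<Rightarrow> 'k) \<Rightarrow> ('n, 'x) nom \<Rightarrow> 'x \<Rightarrow> 'n set" where
  "supp srt A x = \<Inter>{N. finite N \<and> supports srt A N x}"

definition equivariant_rel ::
    "('n \<Rightarrow> 'k) \<Rightarrow> ('n, 'x) nom \<Rightarrow> ('n, 'y) nom \<Rightarrow> ('x \<times> 'y) set \<Rightarrow> bool" where
  "equivariant_rel srt A B R \<longleftrightarrow>
     R \<subseteq> elems A \<times> elems B \<and>
     (\<forall>\<pi>\<in>perms srt. \<forall>(x, y)\<in>R. (perm A \<pi> x, perm B \<pi> y) \<in> R)"

definition prod_nom :: "('n, 'x) nom \<Rightarrow> ('n, 'y) nom \<Rightarrow> ('n, 'x \<times> 'y) nom" where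
  "prod_nom A B = \<lparr>elems = elems A \<times> elems B, perm = (\<lambda>\<pi>. map_prod (perm A \<pi>) (perm B \<pi>))\<rparr>"

definition sum_nom :: "('n, 'x) nom \<Rightarrow> ('n, 'y) nom \<Rightarrow> ('n, 'x + 'y) nom" where
  "sum_nom A B = \<lparr>elems = elems A <+> elems B, perm = (\<lambda>\<pi>. map_sum (perm A \<pi>) (perm B \<pi>))\<rparr>"

definition fin_names :: "('n, 'n set) nom" where
  "fin_names = \<lparr>elems = Fpow UNIV, perm = image\<rparr>"

definition alpha_rel ::
    "('n \<Rightarrow> 'k) \<Rightarrow> ('n, 'x) nom \<Rightarrow> (('n set \<times> 'x) \<times> ('n set \<times> 'x)) set" where
  "alpha_rel srt A =
     {((N, X), (N', X')).
        (N, X) \<in> elems (prod_nom fin_names A) \<and> (N', X') \<in> elems (prod_nom fin_names A) \<and>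
        (\<exists>\<pi>\<in>perms srt. perm (prod_nom fin_names A) \<pi> (N, X) = (N', X') \<and>
                        (\<forall>a \<in> supp srt A X - N. \<pi> a = a))}"

definition name_abs :: "('n \<Rightarrow> 'k) \<Rightarrow> ('n, 'x) nom \<Rightarrow> 'n set \<Rightarrow> 'x \<Rightarrow> ('n set \<times> 'x) set" where
  "name_abs srt A N X = alpha_rel srt A `` {(N, X)}"

definition abs_nom :: "('n \<Rightarrow> 'k) \<Rightarrow> ('n, 'x) nom \<Rightarrow> ('n, ('n set \<times> 'x) set) nom" where
  "abs_nom srt A =
     \<lparr>elems = elems (prod_nom fin_names A) // alpha_rel srt A,
      perm = (\<lambda>\<pi>. image (perm (prod_nom fin_names A) \<pi>))\<rparr>"

section \<open>Nominal transition systems\<close>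

record ('n, 's, 'p, 'a) nts =
  states :: "('n, 's) nom"
  preds :: "('n, 'p) nom"
  acts :: "('n, 'a) nom"
  sat :: "('s \<times> 'p) set"
  bn :: "'a \<Rightarrow> 'n set"
  transitions :: "('s \<times> ('n set \<times> ('a \<times> 's)) set) set"

definition nominal_transition_system :: "('n \<Rightarrow> 'k) \<Rightarrow> ('n, 's, 'p, 'a) nts \<Rightarrow> bool" where
  "nominal_transition_system srt T \<longleftrightarrow>
     nominal_set srt (states T) \<and> nominal_set srt (preds T) \<and> nominal_set srt (acts T) \<and>
     equivariant_rel srt (states T) (preds T) (sat T) \<and>
     (\<forall>\<alpha>\<in>elems (acts T).
        finite (bn T \<alpha>) \<and> bn T \<alpha> \<subseteq> supp srt (acts T) \<alpha> \<and>
        (\<forall>\<pi>\<in>perms srt. bn T (perm (acts T) \<pi> \<alpha>) = \<pi> ` bn T \<alpha>)) \<and>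
     equivariant_rel srt (states T) (abs_nom srt (prod_nom (acts T) (states T))) (transitions T) \<and>
     (\<forall>P N \<alpha> Q. finite N \<and> \<alpha> \<in> elems (acts T) \<and> Q \<in> elems (states T) \<and>
        (P, name_abs srt (prod_nom (acts T) (states T)) N (\<alpha>, Q)) \<in> transitions T \<longrightarrow>
        N = bn T \<alpha>)"

definition step :: "('n \<Rightarrow> 'k) \<Rightarrow> ('n, 's, 'p, 'a) nts \<Rightarrow> 's \<Rightarrow> 'a \<Rightarrow> 's \<Rightarrow> bool" where
  "step srt T P \<alpha> P' \<longleftrightarrow>
     (P, name_abs srt (prod_nom (acts T) (states T)) (bn T \<alpha>) (\<alpha>, P')) \<in> transitions T"

section \<open>Weak bisimilarity\<close>

definition silent_action :: "('n \<Rightarrow> 'k) \<Rightarrow> ('n, 's, 'p, 'a) nts \<Rightarrow> 'a \<Rightarrow> bool" where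
  "silent_action srt T \<tau> \<longleftrightarrow> \<tau> \<in> elems (acts T) \<and> supp srt (acts T) \<tau> = {}"

definition tau_steps ::
    "('n \<Rightarrow> 'k) \<Rightarrow> ('n, 's, 'p, 'a) nts \<Rightarrow> 'a \<Rightarrow> 's \<Rightarrow> 's \<Rightarrow> bool" where
  "tau_steps srt T \<tau> = (\<lambda>P P'. step srt T P \<tau> P')\<^sup>*\<^sup>*"

definition weak_step ::
    "('n \<Rightarrow> 'k) \<Rightarrow> ('n, 's, 'p, 'a) nts \<Rightarrow> 'a \<Rightarrow> 's \<Rightarrow> 'a \<Rightarrow> 's \<Rightarrow> bool" where
  "weak_step srt T \<tau> P \<alpha> P' \<longleftrightarrow>
     (\<exists>P1 P2. tau_steps srt T \<tau> P P1 \<and> step srt T P1 \<alpha> P2 \<and> tau_steps srt T \<tau> P2 P')"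

definition weak_hat_step ::
    "('n \<Rightarrow> 'k) \<Rightarrow> ('n, 's, 'p, 'a) nts \<Rightarrow> 'a \<Rightarrow> 's \<Rightarrow> 'a \<Rightarrow> 's \<Rightarrow> bool" where
  "weak_hat_step srt T \<tau> P \<alpha> P' \<longleftrightarrow>
     (if \<alpha> = \<tau> then tau_steps srt T \<tau> P P' else weak_step srt T \<tau> P \<alpha> P')"

definition weak_bisimulation ::
    "('n \<Rightarrow> 'k) \<Rightarrow> ('n, 's, 'p, 'a) nts \<Rightarrow> 'a \<Rightarrow> ('s \<times> 's) set \<Rightarrow> bool" where
  "weak_bisimulation srt T \<tau> R \<longleftrightarrow>
     R \<subseteq> elems (states T) \<times> elems (states T) \<and> sym R \<and>
     (\<forall>(P, Q)\<in>R.
        (\<forall>\<alpha>\<in>elems (acts T). \<forall>P'\<in>elems (states T).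
           bn T \<alpha> \<inter> supp srt (states T) Q = {} \<and> step srt T P \<alpha> P' \<longrightarrow>
           (\<exists>Q'. weak_hat_step srt T \<tau> Q \<alpha> Q' \<and> (P', Q') \<in> R)) \<and>
        (\<forall>\<phi>\<in>elems (preds T). (P, \<phi>) \<in> sat T \<longrightarrow>
           (\<exists>Q'. tau_steps srt T \<tau> Q Q' \<and> (Q', \<phi>) \<in> sat T \<and> (P, Q') \<in> R)))"

definition weakly_bisimilar ::
    "('n \<Rightarrow> 'k) \<Rightarrow> ('n, 's, 'p, 'a) nts \<Rightarrow> 'a \<Rightarrow> 's \<Rightarrow> 's \<Rightarrow> bool" where
  "weakly_bisimilar srt T \<tau> P Q \<longleftrightarrow> (\<exists>R. weak_bisimulation srt T \<tau> R \<and> (P, Q) \<in> R)"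

section \<open>Turning state predicates into actions\<close>

text \<open>Lemmas \<open>step_pred_to_act\<close> and \<open>nts_pred_to_act\<close> below confirm that the system has exactly the
  intended steps and is a nominal transition system.\<close>

definition pred_to_act ::
    "('n \<Rightarrow> 'k) \<Rightarrow> ('n, 's, 'p, 'a) nts \<Rightarrow> ('n, 's, 'p, 'a + 'p) nts" where
  "pred_to_act srt T =
     (let A = sum_nom (acts T) (preds T);
          b = case_sum (bn T) (\<lambda>_. {});
          cls = (\<lambda>\<beta> P'. name_abs srt (prod_nom A (states T)) (b \<beta>) (\<beta>, P'))
      in \<lparr>states = states T, preds = preds T, acts = A, sat = {}, bn = b,
          transitions =
            {(P, cls (Inl \<alpha>) P') | P \<alpha> P'. \<alpha> \<in> elems (acts T) \<and> P' \<in> elems (states T) \<and> step srt T P \<alpha> P'} \<union>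
            {(P, cls (Inr \<phi>) P) | P \<phi>. (P, \<phi>) \<in> sat T}\<rparr>)"

section \<open>Sanity checks\<close>

lemma perms_id [simp]: "id \<in> perms srt"
  by (simp add: perms_def)

lemma perms_comp: "\<pi> \<in> perms srt \<Longrightarrow> \<rho> \<in> perms srt \<Longrightarrow> \<pi> \<circ> \<rho> \<in> perms srt"
proof -
  assume a: "\<pi> \<in> perms srt" "\<rho> \<in> perms srt"
  have "{a. (\<pi> \<circ> \<rho>) a \<noteq> a} \<subseteq> {a. \<pi> a \<noteq> a} \<union> {a. \<rho> a \<noteq> a}" by auto
  then show ?thesis using a unfolding perms_def
    by (auto simp: bij_comp intro: finite_subset)
qed

lemma perms_inv:
  assumes "\<pi> \<in> perms srt" shows "inv \<pi> \<in> perms srt"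
proof -
  have b: "bij \<pi>" and so: "\<And>a. srt (\<pi> a) = srt a" using assms by (simp_all add: perms_def)
  have inv1: "\<pi> (inv \<pi> a) = a" and inv2: "inv \<pi> (\<pi> a) = a" for a
    using b by (simp_all add: bij_is_surj surj_f_inv_f bij_is_inj)
  have "inv \<pi> a = a" if "\<pi> a = a" for a using inv2[of a] that by simp
  then have "{a. inv \<pi> a \<noteq> a} \<subseteq> {a. \<pi> a \<noteq> a}" by blast
  moreover have "srt (inv \<pi> a) = srt a" for a
    using so[of "inv \<pi> a"] inv1[of a] by simp
  ultimately show ?thesis using assms b unfolding perms_def
    by (auto simp: bij_imp_bij_inv intro: finite_subset)
qed

lemma perms_inv_o:
  assumes "\<pi> \<in> perms srt" shows "inv \<pi> \<circ> \<pi> = id" "\<pi> \<circ> inv \<pi> = id"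
  using assms by (simp_all add: perms_def bij_is_inj bij_is_surj flip: surj_iff)

lemma nominal_setD:
  assumes "nominal_set srt A" "x \<in> elems A"
  shows "perm A id x = x"
    and "\<pi> \<in> perms srt \<Longrightarrow> perm A \<pi> x \<in> elems A"
    and "\<pi> \<in> perms srt \<Longrightarrow> \<rho> \<in> perms srt \<Longrightarrow> perm A (\<pi> \<circ> \<rho>) x = perm A \<pi> (perm A \<rho> x)"
    and "\<exists>N. finite N \<and> supports srt A N x"
  using assms unfolding nominal_set_def by blast+

lemma nominal_set_inv:
  assumes "nominal_set srt A" "\<pi> \<in> perms srt" "x \<in> elems A"
  shows "perm A (inv \<pi>) (perm A \<pi> x) = x"
  using nominal_setD(1)[OF assms(1,3)] nominal_setD(3)[OF assms(1,3) perms_inv[OF assms(2)] assms(2)]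
    perms_inv_o(1)[OF assms(2)] by simp

lemma supports_perm:
  assumes A: "nominal_set srt A" and p: "\<pi> \<in> perms srt" and x: "x \<in> elems A"
    and s: "supports srt A N x"
  shows "supports srt A (\<pi> ` N) (perm A \<pi> x)"
  unfolding supports_def
proof (intro ballI impI)
  fix \<rho> assume r: "\<rho> \<in> perms srt" and fixN: "\<forall>a\<in>\<pi> ` N. \<rho> a = a"
  have inj: "inj \<pi>" using p by (simp add: perms_def bij_is_inj)
  let ?\<sigma> = "inv \<pi> \<circ> (\<rho> \<circ> \<pi>)"
  have sig: "?\<sigma> \<in> perms srt" using p r by (intro perms_comp perms_inv)
  have "\<forall>a\<in>N. ?\<sigma> a = a" using fixN inj by simp
  then have "perm A ?\<sigma> x = x" using s sig unfolding supports_def by blast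
  moreover have "\<pi> \<circ> ?\<sigma> = \<rho> \<circ> \<pi>" using perms_inv_o(2)[OF p] by (simp add: o_assoc)
  ultimately show "perm A \<rho> (perm A \<pi> x) = perm A \<pi> x"
    using nominal_setD(3)[OF A x p sig] nominal_setD(3)[OF A x r p] by simp
qed

lemma supp_perm:
  assumes A: "nominal_set srt A" and p: "\<pi> \<in> perms srt" and x: "x \<in> elems A"
  shows "supp srt A (perm A \<pi> x) = \<pi> ` supp srt A x"
proof -
  have b: "bij \<pi>" using p by (simp add: perms_def)
  have px: "perm A \<pi> x \<in> elems A" using A p x unfolding nominal_set_def by blast
  have "{N. finite N \<and> supports srt A N (perm A \<pi> x)} = image \<pi> ` {N. finite N \<and> supports srt A N x}"
    (is "?L = ?R")
  proof
    show "?R \<subseteq> ?L" using supports_perm[OF A p x] by auto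
    show "?L \<subseteq> ?R"
    proof
      fix N assume "N \<in> ?L"
      then have "finite (inv \<pi> ` N)" "supports srt A (inv \<pi> ` N) x"
        using supports_perm[OF A perms_inv[OF p] px] nominal_set_inv[OF A p x] by auto
      moreover have "N = \<pi> ` (inv \<pi> ` N)" using b by (simp add: bij_is_surj image_f_inv_f)
      ultimately show "N \<in> ?R" by blast
    qed
  qed
  moreover have "{N. finite N \<and> supports srt A N x} \<noteq> {}"
    using nominal_setD(4)[OF A x] by blast
  then have "\<pi> ` \<Inter>{N. finite N \<and> supports srt A N x} = \<Inter>(image \<pi> ` {N. finite N \<and> supports srt A N x})"
    using image_INT[of \<pi> UNIV "{N. finite N \<and> supports srt A N x}" id] b by (auto simp: bij_is_inj)
  ultimately show ?thesis unfolding supp_def by simp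
qed

lemma transpose_perms: "srt a = srt b \<Longrightarrow> transpose a b \<in> perms srt"
proof -
  assume "srt a = srt b"
  moreover have "{c. transpose a b c \<noteq> c} \<subseteq> {a, b}" by (auto simp: transpose_def)
  ultimately show ?thesis unfolding perms_def
    by (auto simp: transpose_def[of a b] finite_subset)
qed

lemma supports_transpose:
  assumes "\<And>a b. srt a = srt b \<Longrightarrow> a \<notin> N \<Longrightarrow> b \<notin> N \<Longrightarrow> perm A (transpose a b) x = x"
    and A: "nominal_set srt A" and x: "x \<in> elems A"
  shows "supports srt A N x"
proof -
  have "perm A \<pi> x = x" if "\<pi> \<in> perms srt" "\<forall>a\<in>N. \<pi> a = a" for \<pi>
    using that
  proof (induction "card {a. \<pi> a \<noteq> a}" arbitrary: \<pi> rule: less_induct)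
    case less
    have bij: "bij \<pi>" and fin: "finite {a. \<pi> a \<noteq> a}" and so: "\<And>a. srt (\<pi> a) = srt a"
      using less.prems by (auto simp: perms_def)
    show ?case
    proof (cases "\<exists>a. \<pi> a \<noteq> a")
      case False
      then have "\<pi> = id" by auto
      then show ?thesis using A x by (simp add: nominal_set_def)
    next
      case True
      then obtain a where a: "\<pi> a \<noteq> a" by blast
      let ?t = "transpose a (\<pi> a)"
      let ?\<rho> = "?t \<circ> \<pi>"
      have t: "?t \<in> perms srt" using transpose_perms[of srt a "\<pi> a"] so[of a] by simp
      have r: "?\<rho> \<in> perms srt" using t less.prems by (intro perms_comp)
      have aN: "a \<notin> N" "\<pi> a \<notin> N"
        using a less.prems(2) bij by (auto dest: bij_is_inj injD)
      have "{c. ?\<rho> c \<noteq> c} \<subset> {c. \<pi> c \<noteq> c}"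
      proof
        show "{c. ?\<rho> c \<noteq> c} \<subseteq> {c. \<pi> c \<noteq> c}"
        proof
          fix c assume c: "c \<in> {c. ?\<rho> c \<noteq> c}"
          show "c \<in> {c. \<pi> c \<noteq> c}"
          proof (rule ccontr)
            assume "c \<notin> {c. \<pi> c \<noteq> c}"
            then have pc: "\<pi> c = c" by simp
            then have "c \<noteq> a" "c \<noteq> \<pi> a" using a bij by (auto dest: bij_is_inj injD)
            then show False using c pc by simp
          qed
        qed
        have "a \<notin> {c. ?\<rho> c \<noteq> c}" "a \<in> {c. \<pi> c \<noteq> c}" using a by simp_all
        then show "{c. ?\<rho> c \<noteq> c} \<noteq> {c. \<pi> c \<noteq> c}" by blast
      qed
      then have "card {c. ?\<rho> c \<noteq> c} < card {c. \<pi> c \<noteq> c}" using fin by (rule psubset_card_mono[rotated])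
      moreover have "\<forall>c\<in>N. ?\<rho> c = c"
        using less.prems(2) aN by (metis comp_apply transpose_apply_other)
      ultimately have "perm A ?\<rho> x = x" using less.hyps r by blast
      moreover have "\<pi> = ?t \<circ> ?\<rho>" by (simp add: fun_eq_iff)
      ultimately have "perm A \<pi> x = perm A ?t x"
        using nominal_setD(3)[OF A x t r] by simp
      then show ?thesis using assms(1)[of a "\<pi> a"] aN so[of a] by simp
    qed
  qed
  then show ?thesis unfolding supports_def by blast
qed

lemma supp_least:
  assumes n: "sorted_names srt" and A: "nominal_set srt A" and x: "x \<in> elems A"
  shows "finite (supp srt A x)" "supports srt A (supp srt A x) x"
    "\<And>N. finite N \<Longrightarrow> supports srt A N x \<Longrightarrow> supp srt A x \<subseteq> N"
proof -
  obtain N0 where N0: "finite N0" "supports srt A N0 x"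
    using A x unfolding nominal_set_def by blast
  show least: "\<And>N. finite N \<Longrightarrow> supports srt A N x \<Longrightarrow> supp srt A x \<subseteq> N"
    unfolding supp_def by blast
  show "finite (supp srt A x)" using least[OF N0] N0(1) by (rule finite_subset)
  have fresh: "perm A (transpose a c) x = x"
    if "finite N" "supports srt A N x" "a \<notin> N" "c \<notin> N" "srt a = srt c" for N a c
  proof -
    have "\<forall>d\<in>N. transpose a c d = d" using that by (metis transpose_apply_other)
    then show ?thesis using that transpose_perms[of srt a c] unfolding supports_def by blast
  qed
  show "supports srt A (supp srt A x) x"
  proof (rule supports_transpose[OF _ A x])
    fix a b assume ab: "srt a = srt b" "a \<notin> supp srt A x" "b \<notin> supp srt A x"
    obtain N1 where N1: "finite N1" "supports srt A N1 x" "a \<notin> N1" using ab unfolding supp_def by blast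
    obtain N2 where N2: "finite N2" "supports srt A N2 x" "b \<notin> N2" using ab unfolding supp_def by blast
    have "infinite {c. srt c = srt a}" using n unfolding sorted_names_def by blast
    then have "infinite ({c. srt c = srt a} - (N1 \<union> N2 \<union> {a, b}))" using N1 N2 by simp
    then have "{c. srt c = srt a} - (N1 \<union> N2 \<union> {a, b}) \<noteq> {}" by (rule infinite_imp_nonempty)
    then obtain c where c: "srt c = srt a" "c \<notin> N1" "c \<notin> N2" "c \<noteq> a" "c \<noteq> b" by blast
    have 1: "perm A (transpose a c) x = x" and 2: "perm A (transpose b c) x = x"
      using fresh[OF N1(1,2,3) c(2)] fresh[OF N2(1,2,3) c(3)] c(1) ab(1) by auto
    have t: "transpose a c \<in> perms srt" "transpose b c \<in> perms srt"
      using transpose_perms[of srt] c(1) ab(1) by auto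
    show "perm A (transpose a b) x = x"
    proof (cases "a = b")
      case True
      then show ?thesis using A x by (simp add: nominal_set_def)
    next
      case False
      have "transpose a b = transpose a c \<circ> (transpose b c \<circ> transpose a c)"
        using c False by (auto simp: fun_eq_iff transpose_def)
      then show ?thesis
        using 1 2 nominal_setD(3)[OF A x t(1) perms_comp[OF t(2,1)]] nominal_setD(3)[OF A x t(2,1)] by simp
    qed
  qed
qed

lemma nominal_set_prod:
  assumes A: "nominal_set srt A" and B: "nominal_set srt B"
  shows "nominal_set srt (prod_nom A B)"
proof -
  have "\<exists>N. finite N \<and> supports srt (prod_nom A B) N (x, y)" if xy: "x \<in> elems A" "y \<in> elems B" for x y
  proof -
    obtain N where N: "finite N" "supports srt A N x" using A xy unfolding nominal_set_def by blast
    obtain M where M: "finite M" "supports srt B M y" using B xy unfolding nominal_set_def by blast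
    have "supports srt (prod_nom A B) (N \<union> M) (x, y)"
      using N(2) M(2) unfolding supports_def prod_nom_def by simp
    then show ?thesis using N(1) M(1) by blast
  qed
  then show ?thesis using A B unfolding nominal_set_def by (auto simp: prod_nom_def)
qed

lemma supports_sum [simp]:
  "supports srt (sum_nom A B) N (Inl x) = supports srt A N x"
  "supports srt (sum_nom A B) N (Inr y) = supports srt B N y"
  unfolding supports_def sum_nom_def by auto

lemma nominal_set_sum:
  assumes A: "nominal_set srt A" and B: "nominal_set srt B"
  shows "nominal_set srt (sum_nom A B)"
proof -
  have "\<exists>N. finite N \<and> supports srt (sum_nom A B) N z" if "z \<in> elems (sum_nom A B)" for z
    using that A B unfolding nominal_set_def by (auto simp: sum_nom_def[THEN arg_cong[where f = elems]])
  then show ?thesis using A B unfolding nominal_set_def by (auto simp: sum_nom_def)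
qed

lemma supp_sum [simp]:
  "supp srt (sum_nom A B) (Inl x) = supp srt A x"
  "supp srt (sum_nom A B) (Inr y) = supp srt B y"
  unfolding supp_def by simp_all

lemma supp_prod_Inl:
  "supp srt (prod_nom (sum_nom A B) S) (Inl x, y) = supp srt (prod_nom A S) (x, y)"
  unfolding supp_def supports_def by (simp add: prod_nom_def sum_nom_def)

lemma equiv_alpha_rel:
  assumes A: "nominal_set srt A"
  shows "equiv (elems (prod_nom fin_names A)) (alpha_rel srt A)"
proof (rule equivI)
  show "alpha_rel srt A \<subseteq> elems (prod_nom fin_names A) \<times> elems (prod_nom fin_names A)"
    unfolding alpha_rel_def by auto
  show "refl_on (elems (prod_nom fin_names A)) (alpha_rel srt A)"
  proof (rule refl_onI)
    fix z assume z: "z \<in> elems (prod_nom fin_names A)"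
    obtain N X where NX: "z = (N, X)" by fastforce
    have "perm (prod_nom fin_names A) id (N, X) = (N, X)"
      using A z NX by (simp add: prod_nom_def fin_names_def nominal_set_def)
    then show "(z, z) \<in> alpha_rel srt A"
      using z NX unfolding alpha_rel_def by (auto intro!: bexI[where x = id])
  qed
  show "sym (alpha_rel srt A)"
  proof (rule symI)
    fix z z' assume "(z, z') \<in> alpha_rel srt A"
    then obtain N X N' X' \<pi> where z: "z = (N, X)" "z' = (N', X')"
      and el: "z \<in> elems (prod_nom fin_names A)" "z' \<in> elems (prod_nom fin_names A)"
      and p: "\<pi> \<in> perms srt" "\<pi> ` N = N'" "perm A \<pi> X = X'"
      and fx: "\<forall>a \<in> supp srt A X - N. \<pi> a = a"
      unfolding alpha_rel_def by (auto simp: prod_nom_def fin_names_def)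
    have X: "X \<in> elems A" using el z by (simp add: prod_nom_def)
    have inj: "inj \<pi>" using p by (simp add: perms_def bij_is_inj)
    have "inv \<pi> ` N' = N" using p(2) inj by (auto simp: image_inv_f_f)
    moreover have "perm A (inv \<pi>) X' = X" using nominal_set_inv[OF A p(1) X] p(3) by simp
    moreover have "inv \<pi> a = a" if a: "a \<in> supp srt A X' - N'" for a
    proof -
      obtain b where b: "a = \<pi> b" "b \<in> supp srt A X" using a supp_perm[OF A p(1) X] p(3) by auto
      then have "b \<notin> N" using a p(2) by auto
      then have "\<pi> b = b" using fx b by blast
      then show ?thesis using b inj by (metis inv_f_f)
    qed
    ultimately show "(z', z) \<in> alpha_rel srt A"
      using el z perms_inv[OF p(1)] unfolding alpha_rel_def
      by (auto simp: prod_nom_def fin_names_def intro!: bexI[where x = "inv \<pi>"])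
  qed
  show "trans (alpha_rel srt A)"
  proof (rule transI)
    fix z z' z'' assume "(z, z') \<in> alpha_rel srt A" "(z', z'') \<in> alpha_rel srt A"
    then obtain N X N' X' N'' X'' \<pi> \<rho> where z: "z = (N, X)" "z' = (N', X')" "z'' = (N'', X'')"
      and el: "z \<in> elems (prod_nom fin_names A)" "z'' \<in> elems (prod_nom fin_names A)"
      and p: "\<pi> \<in> perms srt" "\<pi> ` N = N'" "perm A \<pi> X = X'"
      and fx: "\<forall>a \<in> supp srt A X - N. \<pi> a = a"
      and r: "\<rho> \<in> perms srt" "\<rho> ` N' = N''" "perm A \<rho> X' = X''"
      and fy: "\<forall>a \<in> supp srt A X' - N'. \<rho> a = a"
      unfolding alpha_rel_def by (auto simp: prod_nom_def fin_names_def)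
    have X: "X \<in> elems A" using el z by (simp add: prod_nom_def)
    have inj: "inj \<pi>" using p by (simp add: perms_def bij_is_inj)
    have "perm A (\<rho> \<circ> \<pi>) X = X''" using nominal_setD(3)[OF A X r(1) p(1)] p r by simp
    moreover have "(\<rho> \<circ> \<pi>) ` N = N''" using p r by auto
    moreover have "(\<rho> \<circ> \<pi>) a = a" if a: "a \<in> supp srt A X - N" for a
    proof -
      have "\<pi> a = a" using fx a by blast
      moreover have "\<pi> a \<in> supp srt A X'" using a supp_perm[OF A p(1) X] p(3) by auto
      moreover have "\<pi> a \<notin> N'" using a p(2) inj by (auto dest: injD)
      ultimately show ?thesis using fy by auto
    qed
    ultimately show "(z, z'') \<in> alpha_rel srt A"
      using el z perms_comp[OF r(1) p(1)] unfolding alpha_rel_def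
      by (auto simp: prod_nom_def fin_names_def image_comp intro!: bexI[where x = "\<rho> \<circ> \<pi>"])
  qed
qed

lemma name_abs_eqD:
  assumes A: "nominal_set srt A" and "(N', X') \<in> elems (prod_nom fin_names A)"
    and "name_abs srt A N X = name_abs srt A N' X'"
  shows "((N, X), (N', X')) \<in> alpha_rel srt A"
proof -
  have "((N', X'), (N', X')) \<in> alpha_rel srt A"
    using equiv_alpha_rel[OF A] assms(2) by (meson equivE refl_onD)
  then have "(N', X') \<in> name_abs srt A N X" using assms(3) by (simp add: name_abs_def)
  then show ?thesis by (simp add: name_abs_def)
qed

lemma name_abs_eqI:
  assumes A: "nominal_set srt A" and "((N, X), (N', X')) \<in> alpha_rel srt A"
  shows "name_abs srt A N X = name_abs srt A N' X'"
  using equiv_class_eq[OF equiv_alpha_rel[OF A] assms(2)] by (simp add: name_abs_def)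

lemma alpha_rel_Inl:
  "((N, (Inl x, y)), (N', (Inl x', y'))) \<in> alpha_rel srt (prod_nom (sum_nom A B) S) \<longleftrightarrow>
   ((N, (x, y)), (N', (x', y'))) \<in> alpha_rel srt (prod_nom A S)"
  unfolding alpha_rel_def by (auto simp: supp_prod_Inl) (auto simp: prod_nom_def sum_nom_def)

lemma alpha_rel_cases:
  assumes "((N, (\<beta>, y)), (N', (\<beta>', y'))) \<in> alpha_rel srt (prod_nom (sum_nom A B) S)"
  shows "isl \<beta> \<longleftrightarrow> isl \<beta>'"
  using assms unfolding alpha_rel_def
  by (cases \<beta>; cases \<beta>') (auto simp: prod_nom_def sum_nom_def)

lemma alpha_rel_emptyD:
  assumes n: "sorted_names srt" and A: "nominal_set srt A"
    and "((N, X), ({}, X')) \<in> alpha_rel srt A"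
  shows "N = {}" "X = X'"
proof -
  from assms(3) obtain \<pi> where p: "\<pi> \<in> perms srt" "\<pi> ` N = {}" "perm A \<pi> X = X'" "X \<in> elems A"
    "\<forall>a \<in> supp srt A X - N. \<pi> a = a"
    unfolding alpha_rel_def by (auto simp: prod_nom_def fin_names_def)
  show "N = {}" using p(2) by simp
  then show "X = X'" using supp_least(2)[OF n A p(4)] p unfolding supports_def by auto
qed

lemma alpha_rel_perm:
  assumes A: "nominal_set srt A" and p: "\<pi> \<in> perms srt"
    and "((N, X), (N', X')) \<in> alpha_rel srt A"
  shows "((\<pi> ` N, perm A \<pi> X), (\<pi> ` N', perm A \<pi> X')) \<in> alpha_rel srt A"
proof -
  from assms(3) obtain \<rho> where r: "\<rho> \<in> perms srt" "\<rho> ` N = N'" "perm A \<rho> X = X'"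
    and el: "X \<in> elems A" "finite N" "X' \<in> elems A" "finite N'"
    and fx: "\<forall>a \<in> supp srt A X - N. \<rho> a = a"
    unfolding alpha_rel_def by (auto simp: prod_nom_def fin_names_def Fpow_def)
  let ?\<sigma> = "\<pi> \<circ> (\<rho> \<circ> inv \<pi>)"
  have inj: "inj \<pi>" using p by (simp add: perms_def bij_is_inj)
  have i: "inv \<pi> \<in> perms srt" using perms_inv[OF p] .
  have ri: "\<rho> \<circ> inv \<pi> \<in> perms srt" using perms_comp[OF r(1) i] .
  have s: "?\<sigma> \<in> perms srt" using perms_comp[OF p ri] .
  have elp: "perm A \<pi> X \<in> elems A" "perm A \<pi> X' \<in> elems A"
    using A p el unfolding nominal_set_def by blast+
  have "perm A ?\<sigma> (perm A \<pi> X) = perm A \<pi> (perm A (\<rho> \<circ> inv \<pi>) (perm A \<pi> X))"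
    using A elp p ri unfolding nominal_set_def by blast
  also have "perm A (\<rho> \<circ> inv \<pi>) (perm A \<pi> X) = perm A \<rho> (perm A (inv \<pi>) (perm A \<pi> X))"
    using A elp r(1) i unfolding nominal_set_def by blast
  also have "perm A (inv \<pi>) (perm A \<pi> X) = X" by (rule nominal_set_inv[OF A p el(1)])
  also have "perm A \<rho> X = X'" by (fact r(3))
  finally have "perm A ?\<sigma> (perm A \<pi> X) = perm A \<pi> X'" .
  moreover have "?\<sigma> ` \<pi> ` N = \<pi> ` N'" using r(2) inj by (auto simp: image_image)
  moreover have "?\<sigma> a = a" if a: "a \<in> supp srt A (perm A \<pi> X) - \<pi> ` N" for a
  proof -
    obtain b where b: "a = \<pi> b" "b \<in> supp srt A X" using a supp_perm[OF A p el(1)] by auto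
    then have "b \<notin> N" using a by auto
    then have "\<rho> b = b" using fx b by blast
    then show ?thesis using b inj by simp
  qed
  ultimately show ?thesis
    using s el elp unfolding alpha_rel_def
    by (auto simp: prod_nom_def fin_names_def Fpow_def simp del: o_apply intro!: bexI[where x = ?\<sigma>])
qed

lemma name_abs_perm:
  assumes A: "nominal_set srt A" and p: "\<pi> \<in> perms srt" and el: "(N, X) \<in> elems (prod_nom fin_names A)"
  shows "perm (abs_nom srt A) \<pi> (name_abs srt A N X) = name_abs srt A (\<pi> ` N) (perm A \<pi> X)"
proof -
  have X: "X \<in> elems A" using el by (simp add: prod_nom_def)
  have inj: "inj \<pi>" and surj: "surj \<pi>" using p by (simp_all add: perms_def bij_is_inj bij_is_surj)
  have i: "inv \<pi> \<in> perms srt" using perms_inv[OF p] .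
  have "(\<pi> ` M, perm A \<pi> Y) \<in> name_abs srt A (\<pi> ` N) (perm A \<pi> X)"
    if "(M, Y) \<in> name_abs srt A N X" for M Y
    using that alpha_rel_perm[OF A p] by (simp add: name_abs_def)
  moreover have "\<exists>M' Y'. (M', Y') \<in> name_abs srt A N X \<and> M = \<pi> ` M' \<and> Y = perm A \<pi> Y'"
    if "(M, Y) \<in> name_abs srt A (\<pi> ` N) (perm A \<pi> X)" for M Y
  proof -
    have al: "((\<pi> ` N, perm A \<pi> X), (M, Y)) \<in> alpha_rel srt A" using that by (simp add: name_abs_def)
    have "((inv \<pi> ` \<pi> ` N, perm A (inv \<pi>) (perm A \<pi> X)), (inv \<pi> ` M, perm A (inv \<pi>) Y)) \<in> alpha_rel srt A"
      using alpha_rel_perm[OF A i al] .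
    then have "(inv \<pi> ` M, perm A (inv \<pi>) Y) \<in> name_abs srt A N X"
      using nominal_set_inv[OF A p X] inj by (simp add: name_abs_def image_inv_f_f)
    moreover have "M = \<pi> ` (inv \<pi> ` M)" using surj by (simp add: image_f_inv_f)
    moreover have "Y \<in> elems A" using al unfolding alpha_rel_def by (auto simp: prod_nom_def)
    then have "Y = perm A \<pi> (perm A (inv \<pi>) Y)"
      using nominal_setD(1,3)[OF A] p i perms_inv_o(2)[OF p] by metis
    ultimately show ?thesis by blast
  qed
  ultimately show ?thesis
    unfolding abs_nom_def prod_nom_def fin_names_def
    by (simp, intro equalityI subsetI) (force simp: image_iff)+
qed

lemma step_elems:
  assumes T: "nominal_transition_system srt T" and "step srt T P \<alpha> P'"
  shows "P \<in> elems (states T)" "\<alpha> \<in> elems (acts T)" "P' \<in> elems (states T)" "finite (bn T \<alpha>)"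
proof -
  let ?A = "prod_nom (acts T) (states T)"
  have A: "nominal_set srt ?A"
    using T by (simp add: nominal_transition_system_def nominal_set_prod)
  have *: "P \<in> elems (states T)" "name_abs srt ?A (bn T \<alpha>) (\<alpha>, P') \<in> elems (abs_nom srt ?A)"
    using assms unfolding nominal_transition_system_def equivariant_rel_def step_def by auto
  show "P \<in> elems (states T)" by (fact *)
  have "name_abs srt ?A (bn T \<alpha>) (\<alpha>, P') \<noteq> {}"
    using * in_quotient_imp_non_empty[OF equiv_alpha_rel[OF A]] by (simp add: abs_nom_def)
  then have "(bn T \<alpha>, (\<alpha>, P')) \<in> elems (prod_nom fin_names ?A)"
    unfolding name_abs_def alpha_rel_def by auto
  then show "\<alpha> \<in> elems (acts T)" "P' \<in> elems (states T)" "finite (bn T \<alpha>)"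
    by (auto simp: prod_nom_def fin_names_def Fpow_def)
qed

lemma step_perm:
  assumes T: "nominal_transition_system srt T" and s: "step srt T P \<alpha> P'" and p: "\<pi> \<in> perms srt"
  shows "step srt T (perm (states T) \<pi> P) (perm (acts T) \<pi> \<alpha>) (perm (states T) \<pi> P')"
proof -
  let ?A = "prod_nom (acts T) (states T)"
  have A: "nominal_set srt ?A"
    using T by (simp add: nominal_transition_system_def nominal_set_prod)
  note el = step_elems[OF T s]
  have "(perm (states T) \<pi> P, perm (abs_nom srt ?A) \<pi> (name_abs srt ?A (bn T \<alpha>) (\<alpha>, P'))) \<in> transitions T"
    using T s p unfolding nominal_transition_system_def equivariant_rel_def step_def by blast
  moreover have "perm (abs_nom srt ?A) \<pi> (name_abs srt ?A (bn T \<alpha>) (\<alpha>, P')) =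
      name_abs srt ?A (\<pi> ` bn T \<alpha>) (perm ?A \<pi> (\<alpha>, P'))"
    using el by (intro name_abs_perm[OF A p]) (simp add: prod_nom_def fin_names_def Fpow_def)
  moreover have "\<pi> ` bn T \<alpha> = bn T (perm (acts T) \<pi> \<alpha>)"
    using T p el unfolding nominal_transition_system_def by simp
  ultimately show ?thesis unfolding step_def by (simp add: prod_nom_def)
qed

lemma pred_to_act_simps [simp]:
  "states (pred_to_act srt T) = states T"
  "preds (pred_to_act srt T) = preds T"
  "acts (pred_to_act srt T) = sum_nom (acts T) (preds T)"
  "sat (pred_to_act srt T) = {}"
  "bn (pred_to_act srt T) (Inl \<alpha>) = bn T \<alpha>"
  "bn (pred_to_act srt T) (Inr \<phi>) = {}"
  by (simp_all add: pred_to_act_def Let_def)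

lemma transitions_pred_to_act:
  "transitions (pred_to_act srt T) =
     {(P, name_abs srt (prod_nom (sum_nom (acts T) (preds T)) (states T)) (bn T \<alpha>) (Inl \<alpha>, P')) | P \<alpha> P'.
        \<alpha> \<in> elems (acts T) \<and> P' \<in> elems (states T) \<and> step srt T P \<alpha> P'} \<union>
     {(P, name_abs srt (prod_nom (sum_nom (acts T) (preds T)) (states T)) {} (Inr \<phi>, P)) | P \<phi>. (P, \<phi>) \<in> sat T}"
  by (simp add: pred_to_act_def Let_def)

lemma transitions_pred_to_actD:
  assumes n: "sorted_names srt" and T: "nominal_transition_system srt T"
    and tr: "(P, name_abs srt (prod_nom (sum_nom (acts T) (preds T)) (states T)) N (\<beta>, P'))
        \<in> transitions (pred_to_act srt T)"
  shows "(\<exists>\<alpha>. \<beta> = Inl \<alpha> \<and> N = bn T \<alpha> \<and> step srt T P \<alpha> P') \<or>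
         (\<exists>\<phi>. \<beta> = Inr \<phi> \<and> N = {} \<and> P' = P \<and> (P, \<phi>) \<in> sat T)"
proof -
  let ?B = "prod_nom (sum_nom (acts T) (preds T)) (states T)"
  let ?A = "prod_nom (acts T) (states T)"
  have A: "nominal_set srt ?A" and B: "nominal_set srt ?B"
    using T by (simp_all add: nominal_transition_system_def nominal_set_prod nominal_set_sum)
  from tr consider
    (act) \<alpha> Q where "step srt T P \<alpha> Q" "name_abs srt ?B N (\<beta>, P') = name_abs srt ?B (bn T \<alpha>) (Inl \<alpha>, Q)"
  | (pred) \<phi> where "(P, \<phi>) \<in> sat T" "name_abs srt ?B N (\<beta>, P') = name_abs srt ?B {} (Inr \<phi>, P)"
    unfolding transitions_pred_to_act by blast
  then show ?thesis
  proof cases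
    case act
    note el = step_elems[OF T act(1)]
    have al: "((N, (\<beta>, P')), (bn T \<alpha>, (Inl \<alpha>, Q))) \<in> alpha_rel srt ?B"
      using el by (intro name_abs_eqD[OF B _ act(2)])
        (auto simp: prod_nom_def sum_nom_def fin_names_def Fpow_def)
    then obtain \<alpha>' where b: "\<beta> = Inl \<alpha>'" using alpha_rel_cases[OF al] by (cases \<beta>) auto
    have al': "((N, (\<alpha>', P')), (bn T \<alpha>, (\<alpha>, Q))) \<in> alpha_rel srt ?A" using al b by (simp add: alpha_rel_Inl)
    then have "finite N" "\<alpha>' \<in> elems (acts T)" "P' \<in> elems (states T)"
      unfolding alpha_rel_def by (auto simp: prod_nom_def fin_names_def Fpow_def)
    moreover have tr': "(P, name_abs srt ?A N (\<alpha>', P')) \<in> transitions T"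
      using name_abs_eqI[OF A al'] act(1) by (simp add: step_def)
    ultimately have "N = bn T \<alpha>'" using T unfolding nominal_transition_system_def by blast
    then show ?thesis using b tr' by (simp add: step_def)
  next
    case pred
    have el: "P \<in> elems (states T)" "\<phi> \<in> elems (preds T)"
      using pred(1) T unfolding nominal_transition_system_def equivariant_rel_def by auto
    have al: "((N, (\<beta>, P')), ({}, (Inr \<phi>, P))) \<in> alpha_rel srt ?B"
      using el by (intro name_abs_eqD[OF B _ pred(2)])
        (auto simp: prod_nom_def sum_nom_def fin_names_def Fpow_def)
    show ?thesis using alpha_rel_emptyD[OF n B al] pred(1) by simp
  qed
qed

lemma step_pred_to_act:
  assumes n: "sorted_names srt" and T: "nominal_transition_system srt T"
  shows "step srt (pred_to_act srt T) P (Inl \<alpha>) P' \<longleftrightarrow> step srt T P \<alpha> P'"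
    and "step srt (pred_to_act srt T) P (Inr \<phi>) P' \<longleftrightarrow> P' = P \<and> (P, \<phi>) \<in> sat T"
proof -
  show "step srt (pred_to_act srt T) P (Inl \<alpha>) P' \<longleftrightarrow> step srt T P \<alpha> P'"
  proof
    assume "step srt (pred_to_act srt T) P (Inl \<alpha>) P'"
    then show "step srt T P \<alpha> P'"
      using transitions_pred_to_actD[OF n T, of P _ "Inl \<alpha>" P'] by (auto simp: step_def[of _ "pred_to_act srt T"])
  next
    assume "step srt T P \<alpha> P'"
    then show "step srt (pred_to_act srt T) P (Inl \<alpha>) P'"
      using step_elems[OF T] unfolding step_def[of _ "pred_to_act srt T"] transitions_pred_to_act
      by (intro UnI1) (simp, blast)
  qed
  show "step srt (pred_to_act srt T) P (Inr \<phi>) P' \<longleftrightarrow> P' = P \<and> (P, \<phi>) \<in> sat T"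
  proof
    assume "step srt (pred_to_act srt T) P (Inr \<phi>) P'"
    then show "P' = P \<and> (P, \<phi>) \<in> sat T"
      using transitions_pred_to_actD[OF n T, of P _ "Inr \<phi>" P'] by (auto simp: step_def[of _ "pred_to_act srt T"])
  next
    assume "P' = P \<and> (P, \<phi>) \<in> sat T"
    then show "step srt (pred_to_act srt T) P (Inr \<phi>) P'"
      unfolding step_def[of _ "pred_to_act srt T"] transitions_pred_to_act by auto
  qed
qed

lemma nts_pred_to_act:
  assumes n: "sorted_names srt" and T: "nominal_transition_system srt T"
  shows "nominal_transition_system srt (pred_to_act srt T)"
proof -
  let ?S = "pred_to_act srt T"
  let ?B = "prod_nom (sum_nom (acts T) (preds T)) (states T)"
  have nom: "nominal_set srt (states T)" "nominal_set srt (preds T)" "nominal_set srt (acts T)"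
    using T by (simp_all add: nominal_transition_system_def)
  have B: "nominal_set srt ?B" using nom by (simp add: nominal_set_prod nominal_set_sum)
  have bnT: "finite (bn T \<alpha>)" "bn T \<alpha> \<subseteq> supp srt (acts T) \<alpha>"
    "\<pi> \<in> perms srt \<Longrightarrow> bn T (perm (acts T) \<pi> \<alpha>) = \<pi> ` bn T \<alpha>" if "\<alpha> \<in> elems (acts T)" for \<alpha> \<pi>
    using T that by (simp_all add: nominal_transition_system_def)
  have satT: "P \<in> elems (states T)" "\<phi> \<in> elems (preds T)"
    "\<pi> \<in> perms srt \<Longrightarrow> (perm (states T) \<pi> P, perm (preds T) \<pi> \<phi>) \<in> sat T"
    if "(P, \<phi>) \<in> sat T" for P \<phi> \<pi>
    using T that by (auto simp: nominal_transition_system_def equivariant_rel_def)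
  have bnS: "finite (bn ?S \<beta>) \<and> bn ?S \<beta> \<subseteq> supp srt (acts ?S) \<beta> \<and>
      (\<forall>\<pi>\<in>perms srt. bn ?S (perm (acts ?S) \<pi> \<beta>) = \<pi> ` bn ?S \<beta>)" if "\<beta> \<in> elems (acts ?S)" for \<beta>
  proof (cases \<beta>)
    case (Inl \<alpha>)
    then have "\<alpha> \<in> elems (acts T)" using that by (auto simp: sum_nom_def)
    moreover have "perm (sum_nom (acts T) (preds T)) \<pi> (Inl \<alpha>) = Inl (perm (acts T) \<pi> \<alpha>)" for \<pi>
      by (simp add: sum_nom_def)
    ultimately show ?thesis using bnT Inl by simp
  next
    case (Inr \<phi>)
    moreover have "perm (sum_nom (acts T) (preds T)) \<pi> (Inr \<phi>) = Inr (perm (preds T) \<pi> \<phi>)" for \<pi>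
      by (simp add: sum_nom_def)
    ultimately show ?thesis by simp
  qed
  have trS: "P \<in> elems (states T) \<and> C \<in> elems (abs_nom srt ?B) \<and>
      (\<forall>\<pi>\<in>perms srt. (perm (states T) \<pi> P, perm (abs_nom srt ?B) \<pi> C) \<in> transitions ?S)"
    if tr: "(P, C) \<in> transitions ?S" for P C
  proof -
    obtain \<beta> P' where C: "C = name_abs srt ?B (bn ?S \<beta>) (\<beta>, P')" and st: "step srt ?S P \<beta> P'"
    proof -
      from tr obtain \<beta> P' where "C = name_abs srt ?B (bn ?S \<beta>) (\<beta>, P')"
        unfolding transitions_pred_to_act using that
        by (smt (verit, ccfv_threshold) Pair_inject Un_iff mem_Collect_eq pred_to_act_simps(5,6))
      then show ?thesis using that tr by (simp add: step_def)
    qed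
    have el: "P \<in> elems (states T)" "(bn ?S \<beta>, (\<beta>, P')) \<in> elems (prod_nom fin_names ?B)"
      using st step_elems[OF T] satT bnT
      by (cases \<beta>; auto simp: step_pred_to_act[OF n T] prod_nom_def sum_nom_def fin_names_def Fpow_def)+
    have "C \<in> elems (abs_nom srt ?B)"
      using el C by (simp add: abs_nom_def name_abs_def quotientI)
    moreover have "(perm (states T) \<pi> P, perm (abs_nom srt ?B) \<pi> C) \<in> transitions ?S"
      if p: "\<pi> \<in> perms srt" for \<pi>
    proof -
      have "\<beta> \<in> elems (acts ?S)" using el by (simp add: prod_nom_def)
      then have "bn ?S (perm (acts ?S) \<pi> \<beta>) = \<pi> ` bn ?S \<beta>" using bnS p by blast
      then have "perm (abs_nom srt ?B) \<pi> C =
          name_abs srt ?B (bn ?S (perm (acts ?S) \<pi> \<beta>)) (perm (acts ?S) \<pi> \<beta>, perm (states T) \<pi> P')"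
        using name_abs_perm[OF B p el(2)] C by (simp add: prod_nom_def)
      moreover have "step srt ?S (perm (states T) \<pi> P) (perm (acts ?S) \<pi> \<beta>) (perm (states T) \<pi> P')"
        using st step_perm[OF T _ p] satT(3)[OF _ p]
        by (cases \<beta>) (auto simp: step_pred_to_act[OF n T] sum_nom_def)
      ultimately show ?thesis by (simp add: step_def)
    qed
    ultimately show ?thesis using el by blast
  qed
  have bind: "N = bn ?S \<beta>" if "(P, name_abs srt ?B N (\<beta>, Q)) \<in> transitions ?S" for P N \<beta> Q
    using transitions_pred_to_actD[OF n T that] by auto
  show ?thesis
    unfolding nominal_transition_system_def equivariant_rel_def
    using nom nominal_set_sum[OF nom(3,2)] bnS trS bind by auto
qed

end

theory Submission
  imports Defs
begin

text \<open>A weak bisimulation of the original system is one of the transformed system: a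
  \<open>\<phi>\<close>-transition is a self-loop, so weak static implication provides exactly the weak
  \<open>\<phi>\<close>-transition needed to answer it.\<close>

text \<open>The silent action is \<open>Inl \<tau>\<close>, and the added \<open>Inr\<close>
  self-loops are all visible, so silent paths do not change.\<close>

lemma tau_steps_pred_to_act:
  assumes "sorted_names srt" "nominal_transition_system srt T"
  shows "tau_steps srt (pred_to_act srt T) (Inl \<tau>) = tau_steps srt T \<tau>"
  by (simp add: tau_steps_def step_pred_to_act(1)[OF assms])

text \<open>As \<open>Inl\<close> is injective, both sides fall into the same branch of the case
  split on the silent action.\<close>

lemma weak_hat_step_pred_to_act_Inl:
  assumes "sorted_names srt" "nominal_transition_system srt T"
  shows "weak_hat_step srt (pred_to_act srt T) (Inl \<tau>) P (Inl \<alpha>) P' \<longleftrightarrow>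
    weak_hat_step srt T \<tau> P \<alpha> P'"
  by (simp add: weak_hat_step_def weak_step_def tau_steps_pred_to_act[OF assms]
      step_pred_to_act(1)[OF assms])

text \<open>\<open>Inr \<phi>\<close> is never \<open>Inl \<tau>\<close>, so a visible step must
  occur: run silently to \<open>P'\<close>, take the self-loop there, and end with the empty silent
  path.\<close>

lemma weak_hat_step_pred_to_act_InrI:
  assumes "sorted_names srt" "nominal_transition_system srt T"
    and "tau_steps srt T \<tau> P P'" "(P', \<phi>) \<in> sat T"
  shows "weak_hat_step srt (pred_to_act srt T) (Inl \<tau>) P (Inr \<phi>) P'"
proof -
  have "tau_steps srt T \<tau> P' P'"
    by (simp add: tau_steps_def)
  then show ?thesis
    using assms(3,4)
    by (auto simp: weak_hat_step_def weak_step_def tau_steps_pred_to_act[OF assms(1,2)]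
        step_pred_to_act(2)[OF assms(1,2)])
qed

lemma weak_bisimulation_pred_to_act:
  assumes n: "sorted_names srt" and T: "nominal_transition_system srt T"
    and R: "weak_bisimulation srt T \<tau> R"
  shows "weak_bisimulation srt (pred_to_act srt T) (Inl \<tau>) R"
proof -
  let ?S = "pred_to_act srt T"
  have sim: "\<exists>Q'. weak_hat_step srt T \<tau> Q \<alpha> Q' \<and> (P', Q') \<in> R"
    if "(P, Q) \<in> R" "\<alpha> \<in> elems (acts T)" "P' \<in> elems (states T)"
      "bn T \<alpha> \<inter> supp srt (states T) Q = {}" "step srt T P \<alpha> P'" for P Q \<alpha> P'
    using R that unfolding weak_bisimulation_def by blast
  have static: "\<exists>Q'. tau_steps srt T \<tau> Q Q' \<and> (Q', \<phi>) \<in> sat T \<and> (P, Q') \<in> R"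
    if "(P, Q) \<in> R" "\<phi> \<in> elems (preds T)" "(P, \<phi>) \<in> sat T" for P Q \<phi>
    using R that unfolding weak_bisimulation_def by blast
  \<comment> \<open>Carrier membership of \<open>\<beta>\<close> and \<open>P'\<close> is not
    assumed here; where it matters it is recovered from the transition itself.\<close>
  have "\<exists>Q'. weak_hat_step srt ?S (Inl \<tau>) Q \<beta> Q' \<and> (P', Q') \<in> R"
    if PQ: "(P, Q) \<in> R" and fresh: "bn ?S \<beta> \<inter> supp srt (states T) Q = {}"
      and st: "step srt ?S P \<beta> P'" for P Q \<beta> P'
  proof (cases \<beta>)
    case (Inl \<alpha>)
    then have "step srt T P \<alpha> P'"
      using st by (simp add: step_pred_to_act(1)[OF n T])
    moreover from this have "\<alpha> \<in> elems (acts T)" "P' \<in> elems (states T)"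
      using step_elems[OF T] by blast+
    \<comment> \<open>Freshness carries over because \<open>Inl \<alpha>\<close> binds the same
      names as \<open>\<alpha>\<close> and the states are shared.\<close>
    ultimately have "\<exists>Q'. weak_hat_step srt T \<tau> Q \<alpha> Q' \<and> (P', Q') \<in> R"
      using sim[OF PQ] fresh Inl by simp
    then show ?thesis
      by (simp add: Inl weak_hat_step_pred_to_act_Inl[OF n T])
  next
    case (Inr \<phi>)
    then have "P' = P" and sat: "(P, \<phi>) \<in> sat T"
      using st by (simp_all add: step_pred_to_act(2)[OF n T])
    moreover have "\<phi> \<in> elems (preds T)"
      using sat T by (auto simp: nominal_transition_system_def equivariant_rel_def)
    \<comment> \<open>Static implication relates the unchanged \<open>P\<close> to
      \<open>Q'\<close>, and here \<open>P\<close> is also the target \<open>P'\<close>.\<close>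
    ultimately have "\<exists>Q'. tau_steps srt T \<tau> Q Q' \<and> (Q', \<phi>) \<in> sat T \<and> (P', Q') \<in> R"
      using static[OF PQ] by simp
    then show ?thesis
      using weak_hat_step_pred_to_act_InrI[OF n T] Inr by blast
  qed
  moreover have "R \<subseteq> elems (states T) \<times> elems (states T)" "sym R"
    using R by (simp_all add: weak_bisimulation_def)
  \<comment> \<open>Static implication for the new system is vacuous, since its \<open>sat\<close>
    is empty.\<close>
  ultimately show ?thesis
    unfolding weak_bisimulation_def pred_to_act_simps(1-4) by blast
qed

theorem theorem8p6:
  fixes srt :: "'n \<Rightarrow> 'k"
    and T :: "('n, 's, 'p, 'a) nts"
    and \<tau> :: 'a
    and P Q :: 's
  assumes "sorted_names srt"
    and "nominal_transition_system srt T"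
    and "silent_action srt T \<tau>"
    and "P \<in> elems (states T)"
    and "Q \<in> elems (states T)"
    and "weakly_bisimilar srt T \<tau> P Q"
  shows "weakly_bisimilar srt (pred_to_act srt T) (Inl \<tau>) P Q"
  using assms(6) weak_bisimulation_pred_to_act[OF assms(1,2)]
  unfolding weakly_bisimilar_def by blast

end
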